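(* Let $k\geq2$. The generating function $\sum_{n\geq0}d_nx^n$, where $d_n$ is the number of Dumont permutations of length $n$ that simultaneously avoid the patterns $132$, $123\cdots k$ and $2134\cdots k$, equals $G_{k-1}(x)+xG_{k-2}(x)$.
   Context: A permutation $\pi=\pi_1\cdots\pi_n\in S_n$ is a Dumont permutation (of the first kind) if every even entry $\pi_i$ is followed by a smaller entry ($i<n$ and $\pi_{i+1}<\pi_i$) and every odd entry $\pi_i$ is either last ($i=n$) or followed by a larger entry; the empty permutation is a Dumont permutation. $\pi$ avoids a (classical) pattern $\tau\in S_k$ if no subsequence of $\pi$ of length $k$ is order-isomorphic to $\tau$. $123\cdots k$ is the identity of $[k]$ and $2134\cdots k$ is the permutation of $[k]$ starting $2,1$ followed by $3,\dots,k$. The functions $G_r$ are defined by $G_0(x)=G_1(x)=1$ and $G_r(x)=1+\frac{x^2G_{r-1}(x)}{1-x^2G_{r-2}(x)}$ for $r\geq2$. *)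

theory Defs
  imports
    "HOL-Library.Sublist"
    "HOL-Combinatorics.Multiset_Permutations"
    "HOL-Computational_Algebra.Formal_Power_Series"
begin

text \<open>
  A permutation of $[n]$ is its word: an element of \<^term>\<open>permutations_of_set {1..n::nat}\<close>.
  List positions count from 0, so entry $\pi_i$ of the word is \<open>\<pi> ! (i - 1)\<close>.
\<close>

definition dumont :: "nat list \<Rightarrow> bool" where
  "dumont \<pi> \<longleftrightarrow> (\<forall>i < length \<pi>.
     (even (\<pi> ! i) \<longrightarrow> Suc i < length \<pi> \<and> \<pi> ! Suc i < \<pi> ! i) \<and>
     (odd (\<pi> ! i) \<longrightarrow> Suc i = length \<pi> \<or> \<pi> ! i < \<pi> ! Suc i))"

definition order_isomorphic :: "nat list \<Rightarrow> nat list \<Rightarrow> bool" where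
  "order_isomorphic xs ys \<longleftrightarrow> length xs = length ys \<and>
     (\<forall>i < length xs. \<forall>j < length xs. xs ! i < xs ! j \<longleftrightarrow> ys ! i < ys ! j)"

definition avoids :: "nat list \<Rightarrow> nat list \<Rightarrow> bool" where
  "avoids \<pi> \<tau> \<longleftrightarrow> \<not> (\<exists>\<sigma>. subseq \<sigma> \<pi> \<and> order_isomorphic \<sigma> \<tau>)"

text \<open>
  The denominators have constant coefficient 1, so the division is by a unit of the ring of
  formal power series.
\<close>

fun G :: "nat \<Rightarrow> rat fps" where
  "G 0 = 1"
| "G (Suc 0) = 1"
| "G (Suc (Suc r)) = 1 + fps_X ^ 2 * G (Suc r) / (1 - fps_X ^ 2 * G r)"

end

theory Submission
  imports Defs
begin

text \<open>
  Split a $132$-avoiding Dumont permutation of $[n]$ at its maximum as $\alpha\, n\, \beta$; every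
  entry of $\alpha$ exceeds every entry of $\beta$. If $n$ is odd it comes last, so $\beta$ is empty.
  If $n$ is even, $\beta$ is a nonempty Dumont permutation of some $[j]$, and either $\alpha$ is empty
  or $j$ is even, since an odd $j$ would make the least entry $j + 1$ of $\alpha$ even although nothing
  below it can follow it in $\alpha$. The entry $n$ extends every occurrence in $\alpha$ of
  $12\cdots(k-1)$ or $213\cdots(k-1)$ by one, while for $k \ge 3$ no occurrence of $12\cdots k$ or
  $213\cdots k$ meets both $\alpha\, n$ and $\beta$. Hence the generating function $E_r$ of the
  even-length permutations, with $k = r + 1$, satisfies
  $E_{r+2} - 1 = x^2 E_{r+1} + x^2 E_r (E_{r+2} - 1)$, which is the recurrence of $G$, and the odd
  lengths contribute $x E_{r-1}$.
\<close>

subsection \<open>Pattern containment\<close>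

lemma order_isomorphic_Cons:
  "order_isomorphic (x # xs) (y # ys) \<longleftrightarrow> order_isomorphic xs ys \<and>
     (\<forall>i < length xs. (x < xs ! i \<longleftrightarrow> y < ys ! i) \<and> (xs ! i < x \<longleftrightarrow> ys ! i < y))"
  unfolding order_isomorphic_def by (auto simp: All_less_Suc2)

lemma order_isomorphic_upt:
  "order_isomorphic xs [m..<n] \<longleftrightarrow> length xs = n - m \<and> sorted_wrt (<) xs"
proof
  assume "order_isomorphic xs [m..<n]"
  then show "length xs = n - m \<and> sorted_wrt (<) xs"
    by (auto simp: order_isomorphic_def sorted_wrt_iff_nth_less)
next
  assume *: "length xs = n - m \<and> sorted_wrt (<) xs"
  have "xs ! i < xs ! j \<longleftrightarrow> i < j" if "i < length xs" "j < length xs" for i j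
    using that * sorted_wrt_nth_less[of "(<)" xs]
    by (metis less_asym less_irrefl linorder_neqE_nat)
  then show "order_isomorphic xs [m..<n]"
    using * by (auto simp: order_isomorphic_def)
qed

lemma order_isomorphic_132:
  "order_isomorphic xs [1, 3, 2] \<longleftrightarrow> (\<exists>a c b. xs = [a, c, b] \<and> a < b \<and> b < c)"
proof -
  have "length xs = 3 \<longleftrightarrow> (\<exists>a c b. xs = [a, c, b])"
    by (auto simp: numeral_eq_Suc length_Suc_conv)
  moreover have "order_isomorphic [a, c, b] [1, 3, 2] \<longleftrightarrow> a < b \<and> b < c" for a b c
    by (auto simp: order_isomorphic_def All_less_Suc2)
  moreover have "order_isomorphic xs [1, 3, 2] \<Longrightarrow> length xs = 3"
    by (simp add: order_isomorphic_def)
  ultimately show ?thesis by metis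
qed

lemma order_isomorphic_21_upt:
  "order_isomorphic xs ([2, 1] @ [3..<n + 3]) \<longleftrightarrow>
     (\<exists>b a zs. xs = b # a # zs \<and> a < b \<and> length zs = n \<and> sorted_wrt (<) (b # zs))"
proof (cases "\<exists>b a zs. xs = b # a # zs")
  case True
  then obtain b a zs where "xs = b # a # zs" by blast
  moreover have "order_isomorphic (b # a # zs) (2 # 1 # [3..<n + 3]) \<longleftrightarrow>
      a < b \<and> length zs = n \<and> sorted_wrt (<) (b # zs)"
    by (fastforce simp: order_isomorphic_Cons All_less_Suc2 order_isomorphic_upt all_set_conv_all_nth
        simp del: upt_Suc)
  ultimately show ?thesis by simp
next
  case False
  then have "length xs < 2"
    by (cases xs rule: remdups_adj.cases) auto
  then show ?thesis
    using False by (auto simp: order_isomorphic_def)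
qed

definition avoids_132 :: "nat list \<Rightarrow> bool" where
  "avoids_132 xs \<longleftrightarrow> (\<forall>a c b. subseq [a, c, b] xs \<longrightarrow> \<not> (a < b \<and> b < c))"

lemma avoids_132_iff: "avoids xs [1, 3, 2] \<longleftrightarrow> avoids_132 xs"
  unfolding avoids_def avoids_132_def order_isomorphic_132 by blast

text \<open>
  Containment of one of the patterns $12\cdots k$ and $213\cdots k$ for $k = r + 1$: the first two
  entries are distinct but in no prescribed order. At \<open>r = 0\<close> the only pattern is $1$.
\<close>

fun contains :: "nat \<Rightarrow> nat list \<Rightarrow> bool" where
  "contains 0 xs \<longleftrightarrow> xs \<noteq> []"
| "contains (Suc r) xs \<longleftrightarrow> (\<exists>a b zs. subseq (a # b # zs) xs \<and> a \<noteq> b \<and>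
     length zs = r \<and> sorted_wrt (<) (max a b # zs))"

text \<open>By trichotomy, \<open>a \<noteq> b\<close> splits into \<open>a < b\<close>, an
  occurrence of the increasing pattern, and \<open>b < a\<close>, one of the swapped pattern; in
  both, \<open>max a b\<close> is what the tail has to exceed. At \<open>k = 2\<close> the two
  patterns are 12 and 21.\<close>

lemma contains_iff:
  assumes "k \<ge> 2"
  shows "avoids xs [1..<k+1] \<and> avoids xs ([2, 1] @ [3..<k+1]) \<longleftrightarrow> \<not> contains (k - 1) xs"
proof -
  obtain r where k: "k = r + 2" using assms nat_le_iff_add by (metis add.commute)
  have inc: "order_isomorphic zs [1..<k+1] \<longleftrightarrow>
      (\<exists>a b ws. zs = a # b # ws \<and> a < b \<and> length ws = r \<and> sorted_wrt (<) (b # ws))" for zs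
    unfolding order_isomorphic_upt k
    by (cases zs rule: remdups_adj.cases) (auto dest: less_trans)
  have swp: "order_isomorphic zs ([2, 1] @ [3..<k+1]) \<longleftrightarrow>
      (\<exists>b a ws. zs = b # a # ws \<and> a < b \<and> length ws = r \<and> sorted_wrt (<) (b # ws))" for zs
    using order_isomorphic_21_upt[of zs r] by (simp add: k numeral_3_eq_3 del: upt_Suc)
  have "contains (Suc r) xs \<longleftrightarrow>
      (\<exists>a b ws. subseq (a # b # ws) xs \<and> a < b \<and> length ws = r \<and> sorted_wrt (<) (b # ws)) \<or>
      (\<exists>a b ws. subseq (a # b # ws) xs \<and> b < a \<and> length ws = r \<and> sorted_wrt (<) (a # ws))"
  proof -
    have "a \<noteq> b \<and> length ws = r \<and> sorted_wrt (<) (max a b # ws) \<longleftrightarrow>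
        a < b \<and> length ws = r \<and> sorted_wrt (<) (b # ws) \<or>
        b < a \<and> length ws = r \<and> sorted_wrt (<) (a # ws)" for a b :: nat and ws
      by (cases a b rule: linorder_cases) (simp_all add: max_def)
    then show ?thesis unfolding contains.simps by blast
  qed
  moreover have "k - 1 = Suc r" using k by simp
  ultimately show ?thesis
    unfolding avoids_def inc swp by metis
qed

section \<open>Containment in concatenated words\<close>

lemma subseq_set: "subseq xs ys \<Longrightarrow> set xs \<subseteq> set ys"
  by (auto simp: subseq_conv_nths dest: in_set_nthsD)

lemma contains_mono:
  assumes "contains r xs" "subseq xs ys"
  shows "contains r ys"
proof (cases r)
  case 0
  then show ?thesis using assms by (cases ys) auto
next
  case (Suc s)
  then obtain a b zs where "subseq (a # b # zs) xs" "a \<noteq> b" "length zs = s"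
    "sorted_wrt (<) (max a b # zs)" using assms(1) by auto
  moreover have "subseq (a # b # zs) ys"
    using calculation(1) assms(2) by (rule subseq_order.trans)
  ultimately show ?thesis unfolding Suc contains.simps by blast
qed

text \<open>If x stands before \<open>n\<close> and a larger y after it, then x n y is an occurrence
  of 132. Conversely, an occurrence contained in neither \<open>xs\<close> nor \<open>ys\<close> has
  its 1 in \<open>xs\<close> and its 2 in \<open>ys\<close>, against the order of the
  blocks.\<close>

lemma avoids_132_append_Cons:
  assumes "\<forall>x\<in>set xs. x < n" "\<forall>y\<in>set ys. y < n" "distinct (xs @ ys)"
  shows "avoids_132 (xs @ n # ys) \<longleftrightarrow>
    avoids_132 xs \<and> avoids_132 ys \<and> (\<forall>x\<in>set xs. \<forall>y\<in>set ys. y < x)"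
proof (intro iffI conjI ballI)
  assume av: "avoids_132 (xs @ n # ys)"
  show "avoids_132 xs"
    using av unfolding avoids_132_def by (meson subseq_order.trans subseq_rev_drop_many subseq_order.refl)
  show "avoids_132 ys"
    using av unfolding avoids_132_def by (meson list_emb_append2 list_emb_Cons)
  fix x y assume xy: "x \<in> set xs" "y \<in> set ys"
  have "subseq ([x] @ [n, y]) (xs @ n # ys)"
    using xy by (intro list_emb_append_mono) (auto simp: subseq_singleton_left)
  then have "\<not> x < y"
    using av xy assms(2) unfolding avoids_132_def by fastforce
  moreover have "x \<noteq> y" using xy assms(3) by auto
  ultimately show "y < x" by simp
next
  assume *: "avoids_132 xs \<and> avoids_132 ys \<and> (\<forall>x\<in>set xs. \<forall>y\<in>set ys. y < x)"
  show "avoids_132 (xs @ n # ys)"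
    unfolding avoids_132_def
  proof (intro allI impI notI)
    fix a c b assume sub: "subseq [a, c, b] (xs @ n # ys)" and ord: "a < b \<and> b < c"
    obtain us vs where uv: "[a, c, b] = us @ vs" "subseq us xs" "subseq vs (n # ys)"
      using sub by (auto simp: subseq_append_iff)
    have us: "set us \<subseteq> set xs" and vs: "set vs \<subseteq> insert n (set ys)"
      using subseq_set[OF uv(2)] subseq_set[OF uv(3)] by auto
    have "us = [] \<and> vs = [a, c, b] \<or> us = [a] \<and> vs = [c, b] \<or> us = [a, c] \<and> vs = [b]
        \<or> us = [a, c, b] \<and> vs = []"
      using uv(1) by (cases us; cases "tl us"; cases "tl (tl us)") auto
    then consider "us = []" "vs = [a, c, b]" | "us = [a]" "vs = [c, b]" | "us = [a, c]" "vs = [b]"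
      | "us = [a, c, b]" "vs = []"
      by blast
    then show False
    proof cases
      case 1
      then have "a \<noteq> n" using vs ord assms(2) by auto
      then have "subseq [a, c, b] ys" using uv(3) 1 by (auto simp: subseq_Cons2_neq)
      then show False using * ord unfolding avoids_132_def by blast
    next
      case 2
      then have "b \<in> set ys" using ord vs assms(2) by auto
      moreover have "a \<in> set xs" using 2 us by simp
      ultimately have "b < a" using * by blast
      then show False using ord by simp
    next
      case 3
      then have "b \<in> set ys" using ord us vs assms(1) by auto
      moreover have "a \<in> set xs" using 3 us by simp
      ultimately have "b < a" using * by blast
      then show False using ord by simp
    next
      case 4
      then show False using * ord uv(2) unfolding avoids_132_def by blast
    qed
  qed
qed

text \<open>Deleting the last entry of an occurrence leaves a shorter pattern inside
  \<open>xs\<close>; conversely, \<open>n\<close> exceeds all of \<open>xs\<close> and so prolongs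
  any occurrence there.\<close>

lemma contains_snoc:
  assumes "\<forall>x\<in>set xs. x < n"
  shows "contains (Suc r) (xs @ [n]) \<longleftrightarrow> contains r xs"
proof
  assume "contains (Suc r) (xs @ [n])"
  then obtain a b zs where ab: "subseq (a # b # zs) (xs @ [n])" "a \<noteq> b" "length zs = r"
    "sorted_wrt (<) (max a b # zs)" by auto
  obtain us vs where uv: "a # b # zs = us @ vs" "subseq us xs" "subseq vs [n]"
    using ab(1) by (auto simp: subseq_append_iff)
  have lv: "length vs \<le> 1" using uv(3) list_emb_length by fastforce
  show "contains r xs"
  proof (cases r)
    case 0
    then show ?thesis using uv lv by (cases us) auto
  next
    case (Suc s)
    then obtain ws w where zs: "zs = ws @ [w]" using ab(3) by (cases zs rule: rev_cases) auto
    have "prefix (a # b # ws) us"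
      using uv(1) lv zs by (cases vs rule: rev_cases) (auto simp: prefix_def)
    then have "subseq (a # b # ws) xs"
      using uv(2) subseq_order.trans by blast
    then show ?thesis
      using ab zs Suc by (auto simp: sorted_wrt_append)
  qed
next
  assume c: "contains r xs"
  show "contains (Suc r) (xs @ [n])"
  proof (cases r)
    case 0
    \<comment> \<open>At \<open>r = 0\<close> the shorter pattern is a single entry, and any entry
      of \<open>xs\<close> followed by \<open>n\<close> is a pair of distinct entries.\<close>
    then obtain x where "x \<in> set xs" using c by (cases xs) auto
    then have "subseq ([x] @ [n]) (xs @ [n])"
      by (intro list_emb_append_mono) (auto simp: subseq_singleton_left)
    moreover have "x < n" using \<open>x \<in> set xs\<close> assms by simp
    moreover have "sorted_wrt (<) [max x n]" by simp
    ultimately show ?thesis unfolding 0 contains.simps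
      by (metis append_Cons append_Nil less_irrefl list.size(3))
  next
    case (Suc s)
    then obtain a b zs where ab: "subseq (a # b # zs) xs" "a \<noteq> b" "length zs = s"
      "sorted_wrt (<) (max a b # zs)" using c by auto
    have "subseq ((a # b # zs) @ [n]) (xs @ [n])"
      using ab(1) by (intro list_emb_append_mono) auto
    moreover have "set (a # b # zs) \<subseteq> set xs"
      using ab(1) by (rule subseq_set)
    then have "sorted_wrt (<) (max a b # zs @ [n])"
      using ab(4) assms by (auto simp: sorted_wrt_append)
    ultimately show ?thesis using ab Suc
      unfolding contains.simps by (metis append_Cons length_append_singleton)
  qed
qed

text \<open>From \<open>r = 2\<close> on, every pattern ends in its maximum, so no occurrence can straddle a descent
  of blocks.\<close>

lemma contains_append:
  assumes "\<forall>x\<in>set xs. \<forall>y\<in>set ys. y < x"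
  shows "contains (r + 2) (xs @ ys) \<longleftrightarrow> contains (r + 2) xs \<or> contains (r + 2) ys"
proof
  assume "contains (r + 2) (xs @ ys)"
  then obtain a b zs where ab: "subseq (a # b # zs) (xs @ ys)" "a \<noteq> b" "length zs = Suc r"
    "sorted_wrt (<) (max a b # zs)" by auto
  obtain us vs where uv: "a # b # zs = us @ vs" "subseq us xs" "subseq vs ys"
    using ab(1) by (auto simp: subseq_append_iff)
  have "us = [] \<or> vs = []"
  proof (rule ccontr)
    assume ne: "\<not> (us = [] \<or> vs = [])"
    then have "hd us = a" "last vs = last zs"
      using uv(1) ab(3) by (metis hd_append2 list.sel(1), metis last_ConsR last_appendR list.size(3) list.distinct(1) nat.distinct(1))
    moreover have "a < last zs" using ab(3,4) by (cases zs rule: rev_cases) auto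
    moreover have "hd us \<in> set xs" "last vs \<in> set ys"
      using ne list_emb_set[OF uv(2) hd_in_set] list_emb_set[OF uv(3) last_in_set] by auto
    ultimately show False using assms by force
  qed
  then have "subseq (a # b # zs) xs \<or> subseq (a # b # zs) ys" using uv by auto
  then show "contains (r + 2) xs \<or> contains (r + 2) ys"
    using ab contains.simps(2)[of "Suc r"] by (metis add_2_eq_Suc')
next
  assume "contains (r + 2) xs \<or> contains (r + 2) ys"
  moreover have "subseq xs (xs @ ys)" "subseq ys (xs @ ys)" by auto
  ultimately show "contains (r + 2) (xs @ ys)" using contains_mono by blast
qed

section \<open>Invariance under adding a constant to all entries\<close>

lemma subseq_map_iff:
  "subseq zs (map f xs) \<longleftrightarrow> (\<exists>ws. zs = map f ws \<and> subseq ws xs)"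
  by (auto simp: subseq_conv_nths nths_map)

lemma avoids_132_map_add: "avoids_132 (map ((+) j) xs) \<longleftrightarrow> avoids_132 xs"
proof
  assume av: "avoids_132 (map ((+) j) xs)"
  show "avoids_132 xs"
    unfolding avoids_132_def
  proof (intro allI impI)
    fix a c b assume "subseq [a, c, b] xs"
    from subseq_map[OF this, of "(+) j"] have "subseq [j + a, j + c, j + b] (map ((+) j) xs)" by simp
    then show "\<not> (a < b \<and> b < c)" using av unfolding avoids_132_def by (meson add_less_cancel_left)
  qed
next
  assume "avoids_132 xs"
  then show "avoids_132 (map ((+) j) xs)"
    by (auto simp: avoids_132_def subseq_map_iff Cons_eq_map_conv)
qed

lemma contains_map_add: "contains r (map ((+) j) xs) \<longleftrightarrow> contains r xs"
proof (cases r)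
  case (Suc s)
  have max: "max (j + a) (j + b) = j + max a b" for a b by simp
  have sorted: "sorted_wrt (<) (map ((+) j) ws) \<longleftrightarrow> sorted_wrt (<) ws" for ws
    by (simp add: sorted_wrt_map)
  have "contains r (map ((+) j) xs) \<longleftrightarrow> (\<exists>a b ws. subseq (a # b # ws) xs \<and> j + a \<noteq> j + b \<and>
     length (map ((+) j) ws) = s \<and> sorted_wrt (<) (map ((+) j) (max a b # ws)))"
    unfolding Suc contains.simps subseq_map_iff
    by (simp only: Cons_eq_map_conv list.map max flip: max) (blast intro: max)
  then show ?thesis unfolding sorted by (simp add: Suc)
qed simp

subsection \<open>Dumont permutations\<close>

definition dumont_step :: "nat \<Rightarrow> nat \<Rightarrow> bool" where
  "dumont_step a b \<longleftrightarrow> (if even a then b < a else a < b)"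

text \<open>Only the last entry lacks a successor, which is forbidden for an even entry and allowed
  for an odd one. Everything else concerns neighbours, so words can be cut by the rules for
  \<open>successively\<close>.\<close>

lemma dumont_iff:
  "dumont xs \<longleftrightarrow> successively dumont_step xs \<and> (xs \<noteq> [] \<longrightarrow> odd (last xs))"
proof (cases "xs = []")
  case False
  then obtain m where m: "length xs = Suc m" by (cases xs) auto
  then have "last xs = xs ! m" using False by (simp add: last_conv_nth)
  with m show ?thesis
    unfolding dumont_def successively_conv_nth dumont_step_def
    by (auto simp: All_less_Suc)
qed (simp add: dumont_def)

text \<open>The step from \<open>n\<close> into \<open>ys\<close> is always a descent, but it must
  exist. The step from \<open>last xs\<close> up to \<open>n\<close> is allowed exactly when
  \<open>last xs\<close> is odd, which is the end condition of \<open>xs\<close> itself.\<close>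

lemma dumont_append_Cons_even:
  assumes "\<forall>x\<in>set xs. x < n" "\<forall>y\<in>set ys. y < n" "even n"
  shows "dumont (xs @ n # ys) \<longleftrightarrow> dumont xs \<and> dumont ys \<and> ys \<noteq> []"
proof -
  have "xs \<noteq> [] \<Longrightarrow> dumont_step (last xs) n \<longleftrightarrow> odd (last xs)"
    using assms(1) last_in_set[of xs] by (auto simp: dumont_step_def not_less less_imp_le)
  moreover have "ys \<noteq> [] \<Longrightarrow> dumont_step n (hd ys)"
    using assms by (auto simp: dumont_step_def)
  ultimately show ?thesis using assms(3)
    by (auto simp: dumont_iff successively_append_iff successively_Cons)
qed

lemma dumont_append_Cons_odd:
  assumes "\<forall>x\<in>set xs. x < n" "\<forall>y\<in>set ys. y < n" "odd n"
  shows "dumont (xs @ n # ys) \<longleftrightarrow> dumont xs \<and> ys = []"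
proof -
  have "xs \<noteq> [] \<Longrightarrow> dumont_step (last xs) n \<longleftrightarrow> odd (last xs)"
    using assms(1) last_in_set[of xs] by (auto simp: dumont_step_def not_less less_imp_le)
  moreover have "ys \<noteq> [] \<Longrightarrow> \<not> dumont_step n (hd ys)"
    using assms hd_in_set[of ys] by (auto simp: dumont_step_def not_less less_imp_le)
  ultimately show ?thesis using assms(3)
    by (auto simp: dumont_iff successively_append_iff successively_Cons)
qed

lemma dumont_even_not_minimal:
  assumes "dumont xs" "x \<in> set xs" "even x"
  shows "\<exists>y\<in>set xs. y < x"
  using assms unfolding dumont_def by (metis in_set_conv_nth)

text \<open>Besides the order, an even shift preserves the parity that decides between descent and
  ascent.\<close>

lemma dumont_map_add:
  assumes "even j"
  shows "dumont (map ((+) j) xs) \<longleftrightarrow> dumont xs"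
  using assms by (simp add: dumont_iff successively_map dumont_step_def last_map)

section \<open>The permutations counted for k = r + 1, split at their maximum\<close>

definition dumont_class :: "nat \<Rightarrow> nat \<Rightarrow> nat list set" where
  "dumont_class r n = {xs \<in> permutations_of_set {1..n}. dumont xs \<and> avoids_132 xs \<and> \<not> contains r xs}"

lemma finite_dumont_class [simp]: "finite (dumont_class r n)"
  by (simp add: dumont_class_def)

lemma dumont_class_0: "dumont_class 0 n = (if n = 0 then {[]} else {})"
  by (auto simp: dumont_class_def permutations_of_set_def dumont_def avoids_132_def)

lemma dumont_class_empty: "dumont_class r 0 = {[]}"
  by (cases r) (auto simp: dumont_class_def dumont_def avoids_132_def)

lemma dumont_class_1:
  assumes "n \<ge> 2"
  shows "dumont_class 1 n = {}"
proof -
  have False if "xs \<in> dumont_class 1 n" for xs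
  proof -
    have xs: "distinct xs" "set xs = {1..n}" "\<not> contains 1 xs"
      using that by (auto simp: dumont_class_def permutations_of_set_def)
    then have "length xs \<ge> 2" using assms distinct_card[of xs] by simp
    then obtain a b zs where ab: "xs = a # b # zs"
      by (cases xs rule: remdups_adj.cases) auto
    then have "contains 1 xs" using xs(1) by auto
    then show False using xs(3) by simp
  qed
  then show ?thesis by blast
qed

text \<open>By 132-avoidance every entry after \<open>n\<close> is below every entry before it, so
  the entries after \<open>n\<close> form an initial segment of \<open>{1..<n}\<close>.\<close>

lemma split_at_max:
  assumes "xs \<in> permutations_of_set {1..n}" "n > 0" "avoids_132 xs"
  obtains ys zs j where "xs = ys @ n # zs" "j < n" "distinct ys" "distinct zs"
    "set zs = {1..j}" "set ys = {j<..<n}"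
proof -
  have xs: "set xs = {1..n}" "distinct xs"
    using assms(1) by (auto simp: permutations_of_set_def)
  then have "n \<in> set xs" using assms(2) by auto
  then obtain ys zs where s: "xs = ys @ n # zs" by (auto simp: in_set_conv_decomp)
  have un: "set ys \<union> set zs = {1..<n}"
  proof -
    have "set ys \<union> set zs = set xs - {n}" using xs(2) s by auto
    then show ?thesis using xs(1) by auto
  qed
  have disj: "set ys \<inter> set zs = {}" using xs(2) s by auto
  have gt: "\<forall>y\<in>set ys. \<forall>z\<in>set zs. z < y"
  proof -
    have "\<forall>y\<in>set ys. y < n" "\<forall>z\<in>set zs. z < n" using un by auto
    then show ?thesis using avoids_132_append_Cons[of ys n zs] xs(2) assms(3) s by auto
  qed
  define j where "j = Max (insert 0 (set zs))"
  have j: "j < n" using un assms(2) by (auto simp: j_def)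
  have zj: "z \<le> j" if "z \<in> set zs" for z using that by (simp add: j_def)
  have "set zs = {1..j}"
  proof (intro equalityI subsetI)
    fix z assume "z \<in> {1..j}"
    moreover have "j \<in> insert 0 (set zs)" unfolding j_def by (rule Max_in) auto
    \<comment> \<open>A member \<open>z\<close> of \<open>{1..j}\<close> excludes the default
      \<open>j = 0\<close>, so \<open>j\<close> lies in \<open>zs\<close>; were \<open>z\<close> in
      \<open>ys\<close>, it would exceed \<open>j\<close>.\<close>
    ultimately have "j \<in> set zs" "z \<le> j" "z \<in> {1..<n}" using j by auto
    then show "z \<in> set zs" using un gt by (metis UnE leD)
  qed (use un zj in auto)
  note zs = this
  have "set ys = {1..<n} - set zs" using un disj by blast
  also have "\<dots> = {j<..<n}" unfolding zs by auto
  finally show thesis using that s xs(2) j zs by auto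
qed

lemma append_Cons_permutation:
  fixes n j :: nat
  assumes "distinct ys" "distinct zs" "set zs = {1..j}" "set ys = {j<..<n}" "j < n"
  shows "ys @ n # zs \<in> permutations_of_set {1..n}"
proof (rule permutations_of_setI)
  have "set (ys @ n # zs) = {j<..<n} \<union> insert n {1..j}" using assms by auto
  also have "\<dots> = {1..n}" using assms(5) by auto
  finally show "set (ys @ n # zs) = {1..n}" .
  show "distinct (ys @ n # zs)" using assms by auto
qed

text \<open>An odd maximum is forced to the end, and removing it shortens the forbidden patterns by
  one entry, hence the index drops from \<open>Suc r\<close> to \<open>r\<close>.\<close>

lemma dumont_class_odd:
  assumes "odd n"
  shows "dumont_class (Suc r) n = (\<lambda>xs. xs @ [n]) ` dumont_class r (n - 1)"
proof (intro equalityI subsetI)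
  have n: "n > 0" using assms by (rule odd_pos)
  fix xs assume xs: "xs \<in> dumont_class (Suc r) n"
  then obtain ys zs j where s: "xs = ys @ n # zs" "j < n" "distinct ys" "distinct zs"
    "set zs = {1..j}" "set ys = {j<..<n}"
    using split_at_max n by (metis (no_types, lifting) dumont_class_def mem_Collect_eq)
  have d: "dumont xs" "avoids_132 xs" "\<not> contains (Suc r) xs" using xs by (auto simp: dumont_class_def)
  have "dumont ys" "zs = []" using d(1) dumont_append_Cons_odd[of ys n zs] s assms by auto
  moreover have "avoids_132 ys" using d(2) avoids_132_append_Cons[of ys n zs] s \<open>zs = []\<close> by auto
  moreover have "\<not> contains r ys"
    using d(3) contains_snoc[of ys n r] s \<open>zs = []\<close> by (auto simp del: contains.simps)
  moreover have "set ys = {1..n - 1}" using s \<open>zs = []\<close> by auto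
  ultimately show "xs \<in> (\<lambda>xs. xs @ [n]) ` dumont_class r (n - 1)"
    using s by (auto simp: dumont_class_def permutations_of_set_def)
next
  have n: "n > 0" using assms by (rule odd_pos)
  fix xs assume "xs \<in> (\<lambda>xs. xs @ [n]) ` dumont_class r (n - 1)"
  then obtain ys where ys: "xs = ys @ [n]" "set ys = {1..n - 1}" "distinct ys" "dumont ys"
    "avoids_132 ys" "\<not> contains r ys"
    by (auto simp: dumont_class_def permutations_of_set_def)
  have lt: "\<forall>y\<in>set ys. y < n" using ys(2) n by auto
  have "avoids_132 []" by (simp add: avoids_132_def)
  then show "xs \<in> dumont_class (Suc r) n"
    using ys n lt dumont_append_Cons_odd[of ys n "[]"] avoids_132_append_Cons[of ys n "[]"]
      contains_snoc[of ys n r] assms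
    by (auto simp: dumont_class_def permutations_of_set_def simp del: contains.simps)
qed

lemma card_dumont_class_odd:
  "odd n \<Longrightarrow> card (dumont_class (Suc r) n) = card (dumont_class r (n - 1))"
  by (simp add: dumont_class_odd card_image inj_on_def)

text \<open>Here \<open>ys\<close> keeps its actual values, since its Dumont condition depends on
  parity and \<open>j\<close> may still be odd. The forbidden index drops to \<open>Suc r\<close> on
  \<open>ys\<close>, where \<open>n\<close> completes a pattern, and stays \<open>r + 2\<close> on
  \<open>zs\<close>.\<close>

lemma append_Cons_in_dumont_class_iff:
  assumes "distinct ys" "distinct zs" "set zs = {1..j}" "set ys = {j<..<n}" "j < n" "even n"
  shows "ys @ n # zs \<in> dumont_class (r + 2) n \<longleftrightarrow>
    zs \<in> dumont_class (r + 2) j \<and> 0 < j \<and> dumont ys \<and> avoids_132 ys \<and> \<not> contains (Suc r) ys"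
proof -
  have lt: "\<forall>y\<in>set ys. y < n" "\<forall>z\<in>set zs. z < n" using assms by auto
  \<comment> \<open>Grouping \<open>n\<close> with \<open>ys\<close> makes every entry of the first
    block exceed the second, as \<open>contains_append\<close> requires.\<close>
  have "contains (r + 2) ((ys @ [n]) @ zs) \<longleftrightarrow> contains (r + 2) (ys @ [n]) \<or> contains (r + 2) zs"
    by (rule contains_append) (use assms in auto)
  moreover have "contains (Suc (Suc r)) (ys @ [n]) \<longleftrightarrow> contains (Suc r) ys"
    by (rule contains_snoc) (use assms in auto)
  ultimately have "contains (r + 2) (ys @ n # zs) \<longleftrightarrow> contains (Suc r) ys \<or> contains (r + 2) zs"
    by (simp del: contains.simps)
  moreover have "avoids_132 (ys @ n # zs) \<longleftrightarrow> avoids_132 ys \<and> avoids_132 zs"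
    by (subst avoids_132_append_Cons) (use assms lt in auto)
  moreover have "zs \<noteq> [] \<longleftrightarrow> 0 < j" using assms(3) by (cases zs; force)
  moreover have "zs \<in> permutations_of_set {1..j}" using assms by (auto simp: permutations_of_set_def)
  ultimately show ?thesis
    using append_Cons_permutation[OF assms(1-5)] dumont_append_Cons_even[OF lt assms(6)]
    by (auto simp: dumont_class_def simp del: contains.simps)
qed

lemma dumont_class_even:
  assumes "even n" "n > 0"
  shows "dumont_class (r + 2) n = (\<lambda>(j, ys, zs). map ((+) j) ys @ n # zs) `
    (SIGMA j:{j. 0 < j \<and> j < n \<and> (even j \<or> j = n - 1)}.
       dumont_class (Suc r) (n - 1 - j) \<times> dumont_class (r + 2) j)" (is "_ = ?f ` ?S")
proof (intro equalityI subsetI)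
  fix xs assume xs: "xs \<in> dumont_class (r + 2) n"
  then obtain ys zs j where s: "xs = ys @ n # zs" "j < n" "distinct ys" "distinct zs"
    "set zs = {1..j}" "set ys = {j<..<n}"
    using split_at_max assms(2) by (metis (no_types, lifting) dumont_class_def mem_Collect_eq)
  have d: "zs \<in> dumont_class (r + 2) j" "0 < j" "dumont ys" "avoids_132 ys" "\<not> contains (Suc r) ys"
    using xs append_Cons_in_dumont_class_iff[OF s(3-6,2) assms(1)] s(1) by auto
  have ev: "even j \<or> j = n - 1"
  proof (rule ccontr)
    assume *: "\<not> (even j \<or> j = n - 1)"
    then have "Suc j \<in> set ys" "even (Suc j)" using s(2,6) by auto
    then show False using dumont_even_not_minimal[OF d(3)] s(6) by fastforce
  qed
  \<comment> \<open>All entries of \<open>ys\<close> exceed \<open>j\<close>, so the truncated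
    subtraction is undone by adding \<open>j\<close>.\<close>
  define us where "us = map (\<lambda>x. x - j) ys"
  have us: "ys = map ((+) j) us"
    unfolding us_def using s(6) by (auto intro!: map_idI[symmetric])
  have "distinct us" using s(3) unfolding us by (simp add: distinct_map)
  have "set us = {1..n - 1 - j}"
  proof -
    have "(+) j ` set us = {j<..<n}" using s(6) unfolding us by simp
    also have "\<dots> = {1 + j..n - 1 - j + j}" using s(2) by auto
    also have "\<dots> = (+) j ` {1..n - 1 - j}" by (rule image_add_atLeastAtMost[symmetric])
    finally show ?thesis by (subst (asm) inj_image_eq_iff) auto
  qed
  moreover have "dumont us"
    using ev
  proof
    assume "j = n - 1"
    then have "us = []" using calculation by simp
    then show ?thesis by (simp add: dumont_def)
  qed (use d(3) us dumont_map_add in simp)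
  ultimately have "us \<in> dumont_class (Suc r) (n - 1 - j)"
    using d \<open>distinct us\<close> unfolding us avoids_132_map_add contains_map_add
    by (auto simp: dumont_class_def permutations_of_set_def simp del: contains.simps)
  then have "(j, us, zs) \<in> ?S" using d s(2) ev by auto
  moreover have "xs = ?f (j, us, zs)" using s(1) us by simp
  ultimately show "xs \<in> ?f ` ?S" by blast
next
  fix xs assume "xs \<in> ?f ` ?S"
  then obtain j us zs where s: "xs = map ((+) j) us @ n # zs" "0 < j" "j < n" "even j \<or> j = n - 1"
    "us \<in> dumont_class (Suc r) (n - 1 - j)" "zs \<in> dumont_class (r + 2) j" by auto
  have us: "set us = {1..n - 1 - j}" "distinct us" "dumont us" "avoids_132 us" "\<not> contains (Suc r) us"
    using s(5) by (auto simp: dumont_class_def permutations_of_set_def simp del: contains.simps)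
  have zs: "set zs = {1..j}" "distinct zs" using s(6) by (auto simp: dumont_class_def permutations_of_set_def)
  have "dumont (map ((+) j) us)"
    using s(4)
  proof
    assume "j = n - 1"
    then have "us = []" using us(1) by simp
    then show ?thesis by (simp add: dumont_def)
  qed (use us(3) dumont_map_add in simp)
  moreover have "set (map ((+) j) us) = {j<..<n}"
    using us(1) s(3) by (auto simp: image_add_atLeastAtMost)
  moreover have "distinct (map ((+) j) us)" using us(2) by (simp add: distinct_map)
  moreover have "avoids_132 (map ((+) j) us)" "\<not> contains (Suc r) (map ((+) j) us)"
    unfolding avoids_132_map_add contains_map_add by fact+
  ultimately show "xs \<in> dumont_class (r + 2) n"
    unfolding s(1) using append_Cons_in_dumont_class_iff zs s(2,3,6) assms(1) by blast
qed

lemma card_dumont_class_even: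
  assumes "even n" "n > 0"
  shows "card (dumont_class (r + 2) n) =
    (\<Sum>j | 0 < j \<and> j < n \<and> (even j \<or> j = n - 1).
       card (dumont_class (Suc r) (n - 1 - j)) * card (dumont_class (r + 2) j))"
proof -
  let ?S = "SIGMA j:{j. 0 < j \<and> j < n \<and> (even j \<or> j = n - 1)}.
       dumont_class (Suc r) (n - 1 - j) \<times> dumont_class (r + 2) j"
  have set: "set xs = {1..m}" if "xs \<in> dumont_class s m" for xs s m
    using that by (auto simp: dumont_class_def permutations_of_set_def)
  have "inj_on (\<lambda>(j, ys, zs). map ((+) j) ys @ n # zs) ?S"
  proof (rule inj_onI, simp only: split_paired_all prod.case mem_Sigma_iff mem_Collect_eq, elim conjE)
    fix j ys zs j' ys' zs'
    assume eq: "map ((+) j) ys @ n # zs = map ((+) j') ys' @ n # zs'"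
      and j: "j < n" "j' < n" and zs: "zs \<in> dumont_class (r + 2) j" "zs' \<in> dumont_class (r + 2) j'"
      and ys: "ys \<in> dumont_class (Suc r) (n - 1 - j)" "ys' \<in> dumont_class (Suc r) (n - 1 - j')"
    \<comment> \<open>As \<open>n\<close> occurs only once, it marks the cut; \<open>j\<close> is
      then the number of entries of \<open>zs\<close>.\<close>
    have "n \<notin> set (map ((+) j) ys)" "n \<notin> set zs"
      using set[OF ys(1)] set[OF zs(1)] j by auto
    then have *: "map ((+) j) ys = map ((+) j') ys'" "zs = zs'"
      using eq append_Cons_eq_iff[of n "map ((+) j) ys" zs] by auto
    have "j = j'" using set[OF zs(1)] set[OF zs(2)] *(2) by (metis card_atLeastAtMost diff_Suc_1)
    then show "(j, ys, zs) = (j', ys', zs')" using * by (auto simp: inj_map_eq_map)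
  qed
  then have "card (dumont_class (r + 2) n) = card ?S"
    unfolding dumont_class_even[OF assms, of r] by (rule card_image)
  also have "\<dots> = (\<Sum>j | 0 < j \<and> j < n \<and> (even j \<or> j = n - 1).
       card (dumont_class (Suc r) (n - 1 - j) \<times> dumont_class (r + 2) j))"
    by (rule card_SigmaI) auto
  finally show ?thesis unfolding card_cartesian_product .
qed

subsection \<open>Generating functions\<close>

unbundle fps_syntax

text \<open>Odd coefficients are set to 0 because each \<open>G r\<close> is a series in the square
  of x; odd lengths reduce to even ones by removing the last entry.\<close>

definition even_dumont_fps :: "nat \<Rightarrow> rat fps" where
  "even_dumont_fps r = Abs_fps (\<lambda>n. if even n then of_nat (card (dumont_class r n)) else 0)"

text \<open>Each term loses two entries, giving \<open>fps_X ^ 2\<close>: \<open>n\<close> and the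
  largest entry of the block of odd length, which ends that block. This is the lower block if
  \<open>j = n - 1\<close> and the upper one if \<open>j\<close> is even. Subtracting 1 discards the
  empty lower block.\<close>

lemma even_dumont_fps_rec:
  "even_dumont_fps (r + 2) = 1 + fps_X ^ 2 * even_dumont_fps (Suc r)
     + fps_X ^ 2 * ((even_dumont_fps (r + 2) - 1) * even_dumont_fps r)" (is "?F = ?R")
proof (rule fps_ext)
  fix n :: nat
  let ?P = "(?F - 1) * even_dumont_fps r"
  consider "n = 0" | "odd n" | m where "n = m + 2" "even m"
  proof (cases "n = 0 \<or> odd n")
    case False
    then have "n = (n - 2) + 2" "even (n - 2)" by (cases n; cases "n - 1"; simp)+
    then show ?thesis using that by blast
  qed (use that in blast)
  then show "?F $ n = ?R $ n"
  proof cases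
    case 1
    then show ?thesis by (simp add: even_dumont_fps_def dumont_class_empty fps_X_power_mult_nth)
  next
    case 2
    have "?P $ m = 0" if "odd m" for m
      unfolding fps_mult_nth
    proof (rule sum.neutral, rule ballI)
      fix i assume "i \<in> {0..m}"
      then have "odd i \<or> odd (m - i)" using that by auto
      then show "(?F - 1) $ i * even_dumont_fps r $ (m - i) = 0"
        using that by (cases "i = 0") (auto simp: even_dumont_fps_def)
    qed
    then show ?thesis using 2
      by (cases "n < 2") (auto simp: even_dumont_fps_def fps_X_power_mult_nth elim: oddE)
  next
    case 3
    let ?c = "\<lambda>s i. of_nat (card (dumont_class s i)) :: rat"
    let ?E = "{j. 0 < j \<and> j \<le> m \<and> even j}"
    have J: "{j. 0 < j \<and> j < n \<and> (even j \<or> j = n - 1)} = insert (n - 1) ?E"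
      using 3 by (auto simp: less_Suc_eq_le le_Suc_eq)
    have "n - 1 \<notin> ?E" "finite ?E" using 3 by auto
    \<comment> \<open>The term \<open>j = n - 1\<close> has an empty upper block, which is counted
      once.\<close>
    then have "card (dumont_class (r + 2) n) = card (dumont_class (r + 2) (n - 1)) +
        (\<Sum>j\<in>?E. card (dumont_class (Suc r) (n - 1 - j)) * card (dumont_class (r + 2) j))"
      using card_dumont_class_even[of n r] 3 unfolding J by (simp add: dumont_class_empty)
    then have "?c (r + 2) n = ?c (r + 2) (n - 1) +
        (\<Sum>j\<in>?E. ?c (Suc r) (n - 1 - j) * ?c (r + 2) j)"
      by simp
    also have "?c (r + 2) (n - 1) = ?c (Suc r) m"
      using card_dumont_class_odd[of "n - 1" "Suc r"] 3 by simp
    also have "(\<Sum>j\<in>?E. ?c (Suc r) (n - 1 - j) * ?c (r + 2) j)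
        = (\<Sum>j\<in>?E. (?F - 1) $ j * even_dumont_fps r $ (m - j))"
    proof (rule sum.cong)
      fix j assume j: "j \<in> ?E"
      then have "card (dumont_class (Suc r) (n - 1 - j)) = card (dumont_class r (m - j))"
        using card_dumont_class_odd[of "n - 1 - j" r] 3 by (simp add: Suc_diff_le)
      then show "?c (Suc r) (n - 1 - j) * ?c (r + 2) j = (?F - 1) $ j * even_dumont_fps r $ (m - j)"
        using j 3 by (simp add: even_dumont_fps_def)
    qed simp
    \<comment> \<open>The convolution adds the index 0, where subtracting 1 leaves 0, and the odd
      indices, where the first factor vanishes.\<close>
    also have "\<dots> = ?P $ m"
      unfolding fps_mult_nth
      by (rule sum.mono_neutral_left)
        (auto simp: even_dumont_fps_def dumont_class_empty)
    finally show ?thesis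
      using 3 by (simp add: even_dumont_fps_def fps_X_power_mult_nth)
  qed
qed

text \<open>The recurrence is linear in \<open>even_dumont_fps (r + 2) - 1\<close>; solving for it
  gives the defining equation of \<open>G\<close>.\<close>

lemma even_dumont_fps_eq_G: "even_dumont_fps r = G r"
proof (induction r rule: G.induct)
  case 1
  show ?case by (rule fps_ext) (simp add: even_dumont_fps_def dumont_class_0)
next
  case 2
  \<comment> \<open>The permutation of length 1 does lie in \<open>dumont_class 1 1\<close>, but as
    an odd coefficient it is masked.\<close>
  have "even_dumont_fps 1 $ n = 1 $ n" for n
    using dumont_class_1[of n]
    by (cases "n = 0"; cases "n = 1") (auto simp: even_dumont_fps_def dumont_class_empty)
  then show ?case by (simp add: fps_eq_iff)
next
  case (3 r)
  let ?D = "1 - fps_X ^ 2 * G r :: rat fps"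
  have "?D $ 0 \<noteq> 0" by (simp add: fps_X_power_mult_nth)
  then have D: "?D \<noteq> 0" by (metis fps_zero_nth)
  have "even_dumont_fps (Suc (Suc r)) = 1 + fps_X ^ 2 * G (Suc r)
     + fps_X ^ 2 * ((even_dumont_fps (Suc (Suc r)) - 1) * G r)"
    using even_dumont_fps_rec[of r] 3 by simp
  then have "(even_dumont_fps (Suc (Suc r)) - 1) * ?D = fps_X ^ 2 * G (Suc r)"
    by (simp add: algebra_simps)
  then have "even_dumont_fps (Suc (Suc r)) - 1 = fps_X ^ 2 * G (Suc r) / ?D"
    using D by (metis nonzero_mult_div_cancel_right)
  then show ?case by (simp add: algebra_simps)
qed

theorem theorem4p2:
  fixes k :: nat
  assumes "k \<ge> 2"
  shows "Abs_fps (\<lambda>n. of_nat (card {\<pi> \<in> permutations_of_set {1..n}. dumont \<pi> \<and>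
           avoids \<pi> [1, 3, 2] \<and> avoids \<pi> [1..<k+1] \<and> avoids \<pi> ([2, 1] @ [3..<k+1])}))
         = G (k - 1) + fps_X * G (k - 2)"
proof (rule fps_ext)
  fix n
  have k: "k - 1 = Suc (k - 2)" using assms by simp
  have "{\<pi> \<in> permutations_of_set {1..n}. dumont \<pi> \<and>
      avoids \<pi> [1, 3, 2] \<and> avoids \<pi> [1..<k+1] \<and> avoids \<pi> ([2, 1] @ [3..<k+1])}
      = dumont_class (k - 1) n"
    unfolding dumont_class_def avoids_132_iff contains_iff[OF assms] ..
  \<comment> \<open>Even \<open>n\<close> is read off from \<open>G (k - 1)\<close>; for odd
    \<open>n\<close>, removing the last entry leads to \<open>G (k - 2)\<close> at
    \<open>n - 1\<close>, whence the factor \<open>fps_X\<close>.\<close>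
  moreover have "of_nat (card (dumont_class (k - 1) n)) = (G (k - 1) + fps_X * G (k - 2)) $ n"
    unfolding even_dumont_fps_eq_G[symmetric] k
    by (cases "even n") (auto simp: even_dumont_fps_def card_dumont_class_odd elim: oddE)
  ultimately show "Abs_fps (\<lambda>n. of_nat (card {\<pi> \<in> permutations_of_set {1..n}. dumont \<pi> \<and>
      avoids \<pi> [1, 3, 2] \<and> avoids \<pi> [1..<k+1] \<and> avoids \<pi> ([2, 1] @ [3..<k+1])})) $ n
      = (G (k - 1) + fps_X * G (k - 2)) $ n"
    by simp
qed

end
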